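(* Let $p>1$. The function $f_p$ is Herglotz--Nevanlinna (that is, $f_p$ is analytic on $\mathbb{C}_+$ and $\operatorname{Im} f_p(z)\ge 0$ for all $z\in\mathbb{C}_+$). Moreover, the density $\rho_p$ is strictly positive on $(0,1)$, and the integral representation \[ f_p(z)=\int_{-1}^{1}\frac{\rho_p(|t|)}{t-z}\,dt \] holds for all $z\in\mathbb{C}\setminus[-1,1]$.
   Context: Let $p>1$ and let $q>1$ be the Hölder conjugate index, $1/p+1/q=1$. Write $\mathbb{C}_{\pm}:=\{z\in\mathbb{C} : \pm\operatorname{Im} z>0\}$. Positive powers of a complex argument use the principal branch: for $\alpha>0$, $z^{\alpha}:=|z|^{\alpha}e^{i\alpha\operatorname{Arg} z}$ with $\operatorname{Arg} z\in(-\pi,\pi]$ (and $0^\alpha=0$). The function $f_p$ is defined for $z\in\mathbb{C}\setminus\mathbb{R}$ by \[ f_p(z)=z^{p-1}\left[\left(\left(1+\frac1z\right)^{1/q}-1\right)^{p-1}-\left(1-\left(1-\frac1z\right)^{1/q}\right)^{p-1}\right]. \] It extends analytically to $\mathbb{C}\setminus[-1,1]$, and on $\mathbb{C}\setminus[-1,1]$ the symbol $f_p$ denotes this analytic extension. The function $\rho_p$ is defined for $x\in(0,1]$ by \[ \rho_p(x):=-\frac1\pi\,x^{p-1}\operatorname{Im}\left[\left(1-e^{i\pi/q}\left(\frac1x-1\right)^{1/q}\right)^{p-1}\right], \] and its value at $0$ is understood as the limit of $\rho_p(x)$ for $x\to0_+$ (this limit is $\rho_p(0)=0$). A function $f:\mathbb{C}_+\to\mathbb{C}$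 is called Herglotz--Nevanlinna if it is analytic on $\mathbb{C}_+$ and $\operatorname{Im} f(z)\ge0$ for all $z\in\mathbb{C}_+$. *)

theory Defs
  imports "HOL-Complex_Analysis.Complex_Analysis" "HOL-Real_Asymp.Real_Asymp"
begin

text \<open>
  Complex powers are the library's \<open>powr\<close>: \<open>z powr a = exp (a * Ln z)\<close> with
  \<open>Im (Ln z)\<close> in \<open>(-pi, pi]\<close>, and \<open>0 powr a = 0\<close>, i.e. the principal branch.
\<close>

definition conj_exponent :: "real \<Rightarrow> real" where
  "conj_exponent p = p / (p - 1)"

lemma conj_exponent_iff:
  assumes "p > 1"
  shows "1 / p + 1 / q = 1 \<longleftrightarrow> q = conj_exponent p"
proof -
  have "q \<noteq> 0" if "1 / p + 1 / q = 1"
    using that assms by auto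
  with assms show ?thesis
    by (cases "q = 0") (auto simp: conj_exponent_def field_simps)
qed

lemma conj_exponent_gt_1: "p > 1 \<Longrightarrow> conj_exponent p > 1"
  by (simp add: conj_exponent_def field_simps)

definition f_formula :: "real \<Rightarrow> complex \<Rightarrow> complex" where
  "f_formula p z = z powr of_real (p - 1) *
     (((1 + 1 / z) powr of_real (1 / conj_exponent p) - 1) powr of_real (p - 1) -
      (1 - (1 - 1 / z) powr of_real (1 / conj_exponent p)) powr of_real (p - 1))"

text \<open>
  The formula is used off the real line only; on the slit plane the function is its analytic
  extension. Existence and uniqueness of the extension are proved below.
\<close>

definition is_extension :: "real \<Rightarrow> (complex \<Rightarrow> complex) \<Rightarrow> bool" where
  "is_extension p g \<longleftrightarrow> g analytic_on (- complex_of_real ` {-1..1}) \<and>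
     (\<forall>z. Im z \<noteq> 0 \<longrightarrow> g z = f_formula p z)"

definition f_fun :: "real \<Rightarrow> complex \<Rightarrow> complex" where
  "f_fun p = (SOME g. is_extension p g)"

definition rho_formula :: "real \<Rightarrow> real \<Rightarrow> real" where
  "rho_formula p x = - (1 / pi) * x powr (p - 1) *
     Im ((1 - exp (\<i> * of_real (pi / conj_exponent p)) *
              of_real ((1 / x - 1) powr (1 / conj_exponent p))) powr of_real (p - 1))"

definition rho :: "real \<Rightarrow> real \<Rightarrow> real" where
  "rho p x = (if x = 0 then Lim (at_right 0) (rho_formula p) else rho_formula p x)"

definition herglotz_nevanlinna :: "(complex \<Rightarrow> complex) \<Rightarrow> bool" where
  "herglotz_nevanlinna f \<longleftrightarrow>
     f analytic_on {z. Im z > 0} \<and> (\<forall>z. Im z > 0 \<longrightarrow> Im (f z) \<ge> 0)"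


subsection \<open>Well-definedness\<close>

lemma Im_powr_sgn:
  assumes "Im w \<noteq> 0" "0 < r" "r < 1"
  shows "sgn (Im (w powr of_real r)) = sgn (Im w)"
proof -
  have nz: "w \<noteq> 0" using assms by auto
  have *: "Im (w powr of_real r) = exp (r * Re (Ln w)) * sin (r * Im (Ln w))"
    using nz by (simp add: powr_def Im_exp)
  show ?thesis
  proof (cases "Im w > 0")
    case True
    then have a: "0 < Im (Ln w)" "Im (Ln w) < pi"
      using Im_Ln_pos_lt_imp by (auto simp: nz Im_Ln_pos_lt)
    then have "r * Im (Ln w) < 1 * pi"
      using assms by (intro mult_strict_mono) auto
    then have "sin (r * Im (Ln w)) > 0"
      using a assms by (intro sin_gt_zero) auto
    then show ?thesis using True by (simp add: * sgn_mult)
  next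
    case False
    then have "Im w < 0" using assms by auto
    then have a: "- pi < Im (Ln w)" "Im (Ln w) < 0"
      using Im_Ln_pos_le[OF nz] mpi_less_Im_Ln[OF nz] Im_Ln_le_pi[OF nz] by auto
    have "r * (- Im (Ln w)) < 1 * pi"
      using assms a by (intro mult_strict_mono) auto
    moreover have "r * (- Im (Ln w)) > 0"
      using a assms by (intro mult_pos_pos) auto
    ultimately have "sin (r * (- Im (Ln w))) > 0"
      by (intro sin_gt_zero) auto
    then have "sin (r * Im (Ln w)) < 0" by simp
    then show ?thesis using \<open>Im w < 0\<close> by (simp add: * sgn_mult)
  qed
qed

lemma powr_minus_times:
  assumes "Im z \<noteq> 0" "Im w \<noteq> 0" "sgn (Im w) = - sgn (Im z)"
  shows "(- z) powr a * (- w) powr a = z powr a * w powr (a :: complex)"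
proof -
  have nz: "z \<noteq> 0" "w \<noteq> 0" using assms by auto
  have "Ln (- z) + Ln (- w) = Ln z + Ln w"
    using assms nz by (auto simp: Ln_minus sgn_if split: if_splits)
  then have "a * Ln (- z) + a * Ln (- w) = a * Ln z + a * Ln w"
    by (metis distrib_left)
  then show ?thesis using nz by (simp add: powr_def flip: exp_add)
qed

lemma sgn_Im_inverse:
  assumes "Im z \<noteq> 0"
  shows "Im (1 / z) \<noteq> 0 \<and> sgn (Im (1 / z)) = - sgn (Im z)"
proof -
  define d where "d = (Re z)\<^sup>2 + (Im z)\<^sup>2"
  have d: "d > 0" using assms by (auto simp: d_def intro: add_nonneg_pos)
  have "Im (1 / z) = - Im z / d" by (simp add: Im_divide d_def)
  then show ?thesis using d assms by (simp add: sgn_divide sgn_minus)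
qed

lemma inv_conj_exponent: "p > 1 \<Longrightarrow> 0 < 1 / conj_exponent p \<and> 1 / conj_exponent p < 1"
  by (simp add: conj_exponent_def field_simps)

lemma f_formula_bases:
  assumes "p > 1" "Im z \<noteq> 0"
  shows "sgn (Im ((1 + 1 / z) powr of_real (1 / conj_exponent p) - 1)) = - sgn (Im z)"
    and "sgn (Im (1 - (1 - 1 / z) powr of_real (1 / conj_exponent p))) = - sgn (Im z)"
proof -
  note r = inv_conj_exponent[OF assms(1)]
  note i = sgn_Im_inverse[OF assms(2)]
  have "Im (1 + 1 / z) \<noteq> 0" "Im (1 - 1 / z) \<noteq> 0" using i by simp_all
  from this[THEN Im_powr_sgn] r i
  have "sgn (Im ((1 + 1 / z) powr of_real (1 / conj_exponent p))) = sgn (Im (1 + 1 / z))"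
    "sgn (Im ((1 - 1 / z) powr of_real (1 / conj_exponent p))) = sgn (Im (1 - 1 / z))"
    by blast+
  moreover have "sgn (Im (1 + 1 / z)) = - sgn (Im z)" "sgn (Im (1 - 1 / z)) = sgn (Im z)"
    using i by (simp_all add: sgn_minus)
  ultimately show "sgn (Im ((1 + 1 / z) powr of_real (1 / conj_exponent p) - 1)) = - sgn (Im z)"
    "sgn (Im (1 - (1 - 1 / z) powr of_real (1 / conj_exponent p))) = - sgn (Im z)"
    by (simp_all add: sgn_minus)
qed

lemma f_formula_odd:
  assumes "p > 1" "Im z \<noteq> 0"
  shows "f_formula p (- z) = - f_formula p z"
proof -
  define A where "A = (1 + 1 / z) powr of_real (1 / conj_exponent p) - 1"
  define B where "B = 1 - (1 - 1 / z) powr of_real (1 / conj_exponent p)"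
  note AB = f_formula_bases[OF assms, folded A_def B_def]
  have nz: "Im A \<noteq> 0" "Im B \<noteq> 0" using AB assms(2) by (auto simp: sgn_if split: if_splits)
  have "f_formula p (- z) =
      (- z) powr of_real (p - 1) * (- B) powr of_real (p - 1) -
      (- z) powr of_real (p - 1) * (- A) powr of_real (p - 1)"
    by (simp add: f_formula_def A_def B_def right_diff_distrib)
  also have "\<dots> = z powr of_real (p - 1) * B powr of_real (p - 1) -
      z powr of_real (p - 1) * A powr of_real (p - 1)"
    using powr_minus_times[OF assms(2) nz(1) AB(1)] powr_minus_times[OF assms(2) nz(2) AB(2)]
    by simp
  also have "\<dots> = - f_formula p z"
    by (simp add: f_formula_def A_def B_def right_diff_distrib)
  finally show ?thesis .
qed

lemma Im_nz_nonpos: "Im z \<noteq> 0 \<Longrightarrow> z \<notin> \<real>\<^sub>\<le>\<^sub>0"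
  by (auto simp: complex_nonpos_Reals_iff)

lemma f_formula_holo:
  assumes "p > 1"
  shows "f_formula p holomorphic_on {z. Im z \<noteq> 0 \<or> Re z > 1}"
proof -
  let ?r = "1 / conj_exponent p"
  note r = inv_conj_exponent[OF assms]
  have main: "z \<noteq> 0 \<and> z \<notin> \<real>\<^sub>\<le>\<^sub>0 \<and> 1 + 1 / z \<notin> \<real>\<^sub>\<le>\<^sub>0 \<and> 1 - 1 / z \<notin> \<real>\<^sub>\<le>\<^sub>0 \<and>
      (1 + 1 / z) powr of_real ?r - 1 \<notin> \<real>\<^sub>\<le>\<^sub>0 \<and> 1 - (1 - 1 / z) powr of_real ?r \<notin> \<real>\<^sub>\<le>\<^sub>0"
    if z: "Im z \<noteq> 0 \<or> Re z > 1" for z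
  proof (cases "Im z = 0")
    case False
    have "Im ((1 + 1 / z) powr of_real ?r - 1) \<noteq> 0"
      "Im (1 - (1 - 1 / z) powr of_real ?r) \<noteq> 0"
      using f_formula_bases[OF assms False] False by (metis neg_0_equal_iff_equal sgn_0_0)+
    moreover have "Im (1 + 1 / z) \<noteq> 0" "Im (1 - 1 / z) \<noteq> 0"
      using sgn_Im_inverse[OF False] by simp_all
    ultimately show ?thesis using False Im_nz_nonpos by auto
  next
    case True
    define x where "x = Re z"
    have x: "x > 1" and zx: "z = of_real x"
      using z True by (auto simp: x_def complex_eq_iff)
    have e1: "(1 + 1 / z) = of_real (1 + 1 / x)" "(1 - 1 / z) = of_real (1 - 1 / x)"
      by (simp_all add: zx)
    have pos: "1 + 1 / x > 1" "1 - 1 / x > 0" "1 - 1 / x < 1"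
      using x by (simp_all add: field_simps)
    have e2: "(1 + 1 / z) powr of_real ?r - 1 = of_real ((1 + 1 / x) powr ?r - 1)"
      "1 - (1 - 1 / z) powr of_real ?r = of_real (1 - (1 - 1 / x) powr ?r)"
      unfolding e1 using pos powr_of_real[of "1 + 1 / x" ?r] powr_of_real[of "1 - 1 / x" ?r]
    by (simp_all only: of_real_diff of_real_1)
    have "(1 + 1 / x) powr ?r > 1" using pos r by (intro gr_one_powr) auto
    moreover have "(1 - 1 / x) powr ?r < 1"
      using pos r powr_less_mono2[of ?r "1 - 1 / x" 1] by simp
    ultimately show ?thesis
      unfolding e2 unfolding e1 using x pos
      by (simp add: zx del: of_real_add of_real_diff of_real_divide) (use pos in linarith)
  qed
  show ?thesis
    unfolding f_formula_def[abs_def] using main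
    by (intro holomorphic_intros) blast+
qed

lemma open_slit_plane: "open (- complex_of_real ` {-1..1})"
  by (intro open_Compl compact_imp_closed compact_continuous_image continuous_intros) auto

lemma extension_exists:
  assumes "p > 1"
  shows "\<exists>g. is_extension p g"
proof
  let ?F = "f_formula p"
  define g where "g z = (if Im z \<noteq> 0 \<or> Re z > 1 then ?F z else - ?F (- z))" for z
  let ?U = "{z. Im z \<noteq> 0 \<or> Re z > 1}" and ?V = "{z. Im z \<noteq> 0 \<or> Re z < - 1}"
  have oU: "open ?U" and oV: "open ?V"
    by (intro open_Collect_disj open_Collect_less open_Collect_neq continuous_intros)+
  have hU: "g holomorphic_on ?U"
    by (rule holomorphic_transform[OF f_formula_holo[OF assms]]) (auto simp: g_def)
  have "(?F \<circ> uminus) holomorphic_on ?V"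
  proof (rule holomorphic_on_compose_gen[OF _ f_formula_holo[OF assms]])
    show "(uminus :: complex \<Rightarrow> complex) holomorphic_on ?V"
      by (intro holomorphic_on_minus holomorphic_on_ident)
  qed auto
  then have "(\<lambda>z. - ?F (- z)) holomorphic_on ?V"
    unfolding o_def by (rule holomorphic_on_minus)
  then have hV: "g holomorphic_on ?V"
    by (rule holomorphic_transform) (auto simp: g_def f_formula_odd[OF assms])
  have "g holomorphic_on ?U \<union> ?V"
    using hU hV oU oV by (rule holomorphic_on_Un)
  then have "g analytic_on ?U \<union> ?V"
    using oU oV by (simp add: analytic_on_open open_Un)
  moreover have "- complex_of_real ` {-1..1} \<subseteq> ?U \<union> ?V"
  proof
    fix z assume z: "z \<in> - complex_of_real ` {-1..1}"
    show "z \<in> ?U \<union> ?V"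
    proof (rule ccontr)
      assume "z \<notin> ?U \<union> ?V"
      then have "z = of_real (Re z)" "Re z \<in> {-1..1}" by (auto simp: complex_eq_iff)
      with z show False by blast
    qed
  qed
  ultimately show "is_extension p g"
    unfolding is_extension_def by (auto intro: analytic_on_subset simp: g_def)
qed

lemma extension_unique:
  assumes "is_extension p g" "is_extension p h" "z \<notin> complex_of_real ` {-1..1}"
  shows "g z = h z"
proof -
  let ?S = "- complex_of_real ` {-1..1}"
  let ?X = "\<lambda>n. z + \<i> * of_real (1 / real (Suc n))"
  have "(\<lambda>n. of_real (1 / real (Suc n))) \<longlonglongrightarrow> (of_real 0 :: complex)"
    by (intro tendsto_of_real LIMSEQ_Suc[OF lim_inverse_n'])
  then have "?X \<longlonglongrightarrow> z + \<i> * of_real 0"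
    by (intro tendsto_add tendsto_mult tendsto_const)
  then have lim: "?X \<longlonglongrightarrow> z" by simp
  have lim_at: "(\<lambda>n. k (?X n)) \<longlonglongrightarrow> k z" if "is_extension p k" for k
  proof -
    have "isCont k z"
      using that assms(3) by (auto simp: is_extension_def intro!: analytic_at_imp_isCont
          intro: analytic_on_subset)
    then show ?thesis using lim by (rule isCont_tendsto_compose)
  qed
  have "eventually (\<lambda>n. Im (?X n) \<noteq> 0) sequentially"
  proof (cases "Im z = 0")
    case True then show ?thesis by simp
  next
    case False
    have "(\<lambda>n. Im (?X n)) \<longlonglongrightarrow> Im z" using lim by (rule tendsto_Im)
    then show ?thesis using False by (rule tendsto_imp_eventually_ne)
  qed
  then have "eventually (\<lambda>n. g (?X n) = h (?X n)) sequentially"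
    by eventually_elim (use assms in \<open>auto simp: is_extension_def\<close>)
  then have "(\<lambda>n. g (?X n)) \<longlonglongrightarrow> h z"
    using lim_at[OF assms(2)] by (simp add: tendsto_cong)
  with lim_at[OF assms(1)] show ?thesis by (rule LIMSEQ_unique)
qed

lemma f_fun_extension: "p > 1 \<Longrightarrow> is_extension p (f_fun p)"
  unfolding f_fun_def by (rule someI_ex[OF extension_exists])

lemma rho_0:
  assumes "p > 1"
  shows "(rho_formula p \<longlongrightarrow> 0) (at_right 0)" and "rho p 0 = 0"
proof -
  define r where "r = 1 / conj_exponent p"
  have r: "0 < r" "r < 1" using inv_conj_exponent[OF assms] by (auto simp: r_def)
  let ?b = "\<lambda>x :: real. (1 / pi) * (x * (1 + (1 / x - 1) powr r)) powr (p - 1)"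
  have "((\<lambda>x :: real. x * (1 + (1 / x - 1) powr r)) \<longlongrightarrow> 0) (at_right 0)"
    using r by real_asymp
  then have "((\<lambda>x. (x * (1 + (1 / x - 1) powr r)) powr (p - 1)) \<longlongrightarrow> 0 powr (p - 1)) (at_right 0)"
    using assms
    by (intro tendsto_powr' tendsto_const)
      (auto simp: eventually_at_right_field intro!: exI[of _ 1] mult_nonneg_nonneg add_nonneg_nonneg)
  from tendsto_mult[OF tendsto_const[of "1 / pi"] this]
  have b: "(?b \<longlongrightarrow> 0) (at_right 0)" by simp
  have "eventually (\<lambda>x. norm (rho_formula p x) \<le> ?b x) (at_right 0)"
    using eventually_at_right_less[of 0]
  proof eventually_elim
    case (elim x)
    let ?w = "1 - exp (\<i> * of_real (pi / conj_exponent p)) * of_real ((1 / x - 1) powr r)"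
    have "norm ?w \<le> norm (1 :: complex) +
        norm (exp (\<i> * of_real (pi / conj_exponent p)) * of_real ((1 / x - 1) powr r))"
      by (rule norm_triangle_ineq4)
    also have "\<dots> = 1 + (1 / x - 1) powr r"
      by (simp add: norm_mult)
    finally have w: "norm ?w \<le> 1 + (1 / x - 1) powr r" .
    have "\<bar>Im (?w powr of_real (p - 1))\<bar> \<le> norm (?w powr of_real (p - 1))"
      by (rule abs_Im_le_cmod)
    also have "\<dots> = norm ?w powr (p - 1)"
      by (auto simp: powr_def norm_exp_eq_Re)
    also have "\<dots> \<le> (1 + (1 / x - 1) powr r) powr (p - 1)"
      using w assms by (intro powr_mono2) auto
    finally have "x powr (p - 1) * \<bar>Im (?w powr of_real (p - 1))\<bar> \<le>
        x powr (p - 1) * (1 + (1 / x - 1) powr r) powr (p - 1)"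
      by (intro mult_left_mono) auto
    also have "\<dots> = (x * (1 + (1 / x - 1) powr r)) powr (p - 1)"
      by (simp only: powr_mult)
    finally have "(1 / pi) * (x powr (p - 1) * \<bar>Im (?w powr of_real (p - 1))\<bar>) \<le> ?b x"
      by (intro mult_left_mono) auto
    then show ?case
      by (simp add: rho_formula_def r_def abs_mult)
  qed
  then show *: "(rho_formula p \<longlongrightarrow> 0) (at_right 0)"
    using b by (rule Lim_null_comparison)
  show "rho p 0 = 0"
    unfolding rho_def using * by (simp add: tendsto_Lim)
qed

end

theory Submission
  imports Defs
begin

text \<open>
  Put \<open>r = 1/q\<close> and \<open>s = p - 1\<close>, so that \<open>r * (1 + s) = s\<close>. The second half of \<open>f\<close>, namely
  \<open>F z = z^s (1 - (1 - 1/z)^r)^s\<close>, equals \<open>z^r (z^r - (z - 1)^r)^s\<close> on the upper half plane; in this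
  form it is continuous up to the real axis, real outside \<open>[0,1]\<close>, and \<open>Im F = - pi * rho\<close> on \<open>[0,1]\<close>.
  It tends to \<open>r^s\<close> at infinity, so Cauchy's formula gives \<open>F z = r^s - \<integral> rho t / (t - z) dt\<close>
  over \<open>[0,1]\<close>. Since \<open>f z = cnj (F (- cnj z)) - F z\<close>, the constants cancel and the two integrals
  combine to the one over \<open>[-1,1]\<close>; oddness covers the lower half plane and continuity the rest of
  the real axis. Positivity of \<open>rho\<close>: \<open>1 - exp (i pi r) Y\<close> has argument in \<open>(- pi (1 - r), 0)\<close>
  for \<open>Y > 0\<close>, and \<open>s (1 - r) = r < 1\<close>.
\<close>

section \<open>Cauchy's formula on half discs and recovery from boundary values\<close>

text \<open>The full circle winds once around \<open>z\<close> and splits into an upper and a lower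
  arc. The lower arc followed by the reversed diameter stays in the closed lower half plane, a
  convex set that misses \<open>z\<close>, so it has winding number 0. Hence the diameter can
  replace the lower arc.\<close>

lemma winding_number_upper_half_disc:
  assumes "0 < Im z" "cmod z < R"
  shows "winding_number (linepath (- of_real R) (of_real R) +++ part_circlepath 0 R 0 pi) z = 1"
proof -
  have R: "R > 0" using assms norm_ge_zero[of z] by linarith
  let ?L = "linepath (- of_real R) (of_real R :: complex)"
  let ?U = "part_circlepath 0 R 0 pi" and ?D = "part_circlepath 0 R pi (2*pi)"
  have zL: "z \<notin> closed_segment (- of_real R) (of_real R)"
  proof
    assume "z \<in> closed_segment (- of_real R) (of_real R)"
    then have "Im z = 0" by (auto simp: in_segment)
    with assms show False by simp
  qed
  have zc: "z \<notin> path_image (part_circlepath 0 R a b)" if "a \<le> b" for a b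
    using assms R that by (auto dest!: in_path_image_part_circlepath)
  have ends: "pathstart ?U = of_real R" "pathfinish ?U = - of_real R"
    "pathstart ?D = - of_real R" "pathfinish ?D = of_real R"
    using exp_two_pi_i by (simp_all add: exp_pi_i' mult.commute)
  have "?U +++ ?D = circlepath 0 R"
  proof
    fix x :: real
    show "(?U +++ ?D) x = circlepath 0 R x"
      by (auto simp: joinpaths_def circlepath_def part_circlepath_def linepath_def algebra_simps)
  qed
  moreover have "winding_number (circlepath 0 R) z = 1"
    using assms by (intro winding_number_circlepath) auto
  ultimately have 1: "winding_number ?U z + winding_number ?D z = 1"
    using winding_number_join[of ?U z ?D] zc ends by simp
  have "sin t \<le> 0" if "pi \<le> t" "t \<le> 2 * pi" for t
    using sin_ge_zero[of "t - pi"] that by (simp add: sin_diff)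
  then have "path_image ?D \<subseteq> {w. Im w \<le> 0}"
    using R by (auto simp: path_image_part_circlepath' closed_segment_eq_real_ivl Im_exp
        intro!: mult_nonneg_nonpos split: if_splits)
  moreover have "path_image (reversepath ?L) \<subseteq> {w. Im w \<le> 0}"
    by (auto simp: in_segment)
  ultimately have "path_image (?D +++ reversepath ?L) \<subseteq> {w. Im w \<le> 0}"
    using ends by (simp add: path_image_join)
  then have "winding_number (?D +++ reversepath ?L) z = 0"
    using assms ends
    by (intro winding_number_zero_outside[of _ "{w. Im w \<le> 0}"] convex_halfspace_Im_le) auto
  then have 2: "winding_number ?D z = winding_number ?L z"
    using winding_number_join[of ?D z "reversepath ?L"] winding_number_reversepath[of ?L z] zc zL ends
    by (simp add: closed_segment_commute)
  show ?thesis
    using winding_number_join[of ?L z ?U] zc zL ends 1 2 by (simp add: add.commute)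
qed

text \<open>
  Cauchy's formula on large half discs, at \<open>z\<close> and at \<open>cnj z\<close> (where it gives 0). Conjugating the
  latter and subtracting leaves only \<open>Im F\<close> on the real axis.
\<close>

lemma half_plane_Cauchy:
  fixes F :: "complex \<Rightarrow> complex" and a b c :: real
  assumes cont: "continuous_on {z. 0 \<le> Im z} F" and hol: "F holomorphic_on {z. 0 < Im z}"
    and lim: "(F \<longlongrightarrow> of_real c) (inf at_infinity (principal {z. 0 < Im z}))"
    and real: "\<And>x. x \<notin> {a..b} \<Longrightarrow> Im (F (of_real x)) = 0"
    and z: "0 < Im z"
  shows "((\<lambda>x. of_real (Im (F (of_real x))) / (of_real x - z)) has_integral
            of_real pi * (F z - of_real c)) {a..b}"
proof -
  define G where "G w = F w - of_real c" for w
  let ?H = "{z. 0 \<le> Im z}"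
  have contG: "continuous_on ?H G" unfolding G_def by (intro continuous_intros cont)
  have holG: "G holomorphic_on {z. 0 < Im z}" unfolding G_def by (intro holomorphic_intros hol)
  have int: "interior ?H = {z. 0 < Im z}"
    using interior_halfspace_ge[of \<i> 0] by (simp add: inner_complex_def)
  have cvx: "convex ?H" by (rule convex_halfspace_Im_ge)
  have fdG: "G field_differentiable at x" if "0 < Im x" for x
    using holG that open_halfspace_Im_gt[of 0]
    by (auto simp: holomorphic_on_open field_differentiable_def)
  have limG: "(G \<longlongrightarrow> 0) (inf at_infinity (principal {z. 0 < Im z}))"
    using tendsto_diff[OF lim tendsto_const[of "of_real c"]] by (simp add: G_def[abs_def])
  \<comment> \<open>As \<open>c\<close> is real, it drops out of this difference. On the real axis,
    conjugation also turns the kernel of \<open>cnj z\<close> into that of \<open>z\<close>.\<close>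
  have Gcnj: "G (of_real x) - cnj (G (of_real x)) = 2 * \<i> * of_real (Im (F (of_real x)))" for x
    by (simp add: G_def complex_eq_iff)
  define I where "I x = of_real (Im (F (of_real x))) / (of_real x - z)" for x :: real
  have nz: "of_real x - z \<noteq> 0" "of_real x - cnj z \<noteq> 0" for x
    using z by (auto simp: complex_eq_iff)
  have contF: "continuous_on X (\<lambda>x. F (of_real x))" for X :: "real set"
    by (rule continuous_on_compose2[OF cont]) (auto intro!: continuous_intros)
  have contI: "continuous_on X I" for X
    unfolding I_def using nz by (intro continuous_intros contF) auto
  have I_int: "I integrable_on {x..y}" for x y
    by (intro integrable_continuous_real contI)
  have key: "cmod (2 * pi * \<i> * G z - 2 * \<i> * integral {a..b} I) \<le> e" if e: "e > 0" for e
  proof -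
    \<comment> \<open>The arc has length \<open>pi * R\<close> and the denominators there are at
      least \<open>R / 2\<close>, so each arc integral is at most
      \<open>2 * pi * d = e / 2\<close>.\<close>
    define d where "d = e / (4 * pi)"
    have d: "d > 0" using e by (simp add: d_def)
    from tendstoD[OF limG d] obtain R0 where
      R0: "\<And>w. R0 \<le> cmod w \<Longrightarrow> 0 < Im w \<Longrightarrow> cmod (G w) < d"
      by (auto simp: eventually_inf_principal eventually_at_infinity)
    \<comment> \<open>\<open>R0\<close> makes \<open>G\<close> small on the arc,
      \<open>2 * cmod z\<close> gives the denominator bound, and the last term puts
      \<open>{a..b}\<close> inside the diameter.\<close>
    define R where "R = max R0 (max (2 * cmod z) (\<bar>a\<bar> + \<bar>b\<bar>))"
    have z0: "cmod z > 0" using z by auto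
    have R: "R0 \<le> R" "2 * cmod z \<le> R" "\<bar>a\<bar> + \<bar>b\<bar> \<le> R" "R > 0" "cmod z < R" 
      using z0 unfolding R_def by linarith+
    let ?L = "linepath (- of_real R) (of_real R :: complex)" and ?U = "part_circlepath 0 R 0 pi"
    have ends: "pathstart ?U = of_real R" "pathfinish ?U = - of_real R"
      by (simp_all add: exp_pi_i')
    have imL: "path_image ?L \<subseteq> {w. Im w = 0}" by (auto simp: in_segment)
    have imU: "path_image ?U \<subseteq> ?H"
      using R by (auto simp: path_image_part_circlepath' closed_segment_eq_real_ivl Im_exp
          intro!: mult_nonneg_nonneg sin_ge_zero)
    have imU': "cmod w = R" if "w \<in> path_image ?U" for w
      using in_path_image_part_circlepath[OF that] R by simp
    have "z \<notin> path_image ?L" "z \<notin> path_image ?U"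
      using imL imU' R(5) z by auto
    moreover have "path_image ?L \<subseteq> ?H" using imL by auto
    ultimately have im: "path_image (?L +++ ?U) \<subseteq> ?H - {z}"
      using imU ends path_image_join_subset[of ?L ?U] by blast
    have vp: "valid_path (?L +++ ?U)" and loop: "pathfinish (?L +++ ?U) = pathstart (?L +++ ?U)"
      using ends by auto
    have "((\<lambda>w. G w / (w - z)) has_contour_integral
        (2 * pi * \<i> * winding_number (?L +++ ?U) z * G z)) (?L +++ ?U)"
      by (rule Cauchy_integral_formula_weak[OF cvx _ contG _ _ vp im loop, of "{}"])
        (use z fdG in \<open>auto simp: int\<close>)
    then have C1: "((\<lambda>w. G w / (w - z)) has_contour_integral 2 * pi * \<i> * G z) (?L +++ ?U)"
      using winding_number_upper_half_disc[OF z, of R] R by simp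
    have nzc: "w - cnj z \<noteq> 0" if "0 \<le> Im w" for w
      using that z by (auto simp: complex_eq_iff)
    have C2: "((\<lambda>w. G w / (w - cnj z)) has_contour_integral 0) (?L +++ ?U)"
    proof (rule Cauchy_theorem_convex[OF _ cvx, of _ "{}"])
      show "continuous_on ?H (\<lambda>w. G w / (w - cnj z))"
        using nzc by (intro continuous_intros contG) auto
      show "(\<lambda>w. G w / (w - cnj z)) field_differentiable at x" if "x \<in> interior ?H - {}" for x
        using that nzc[of x] by (auto simp: int intro!: derivative_intros fdG)
    qed (use vp loop im in auto)
    have split: "\<exists>A B. (f has_contour_integral A) ?L \<and> (f has_contour_integral B) ?U \<and> A + B = i"
      if "(f has_contour_integral i) (?L +++ ?U)" for f i
    proof -
      have "f contour_integrable_on (?L +++ ?U)"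
        using that by (auto simp: contour_integrable_on_def)
      then have "f contour_integrable_on ?L" "f contour_integrable_on ?U"
        using ends contour_integrable_joinD1 contour_integrable_joinD2 by (metis valid_path_linepath valid_path_part_circlepath)+
      then obtain A B where AB: "(f has_contour_integral A) ?L" "(f has_contour_integral B) ?U"
        by (auto simp: contour_integrable_on_def)
      then have "(f has_contour_integral A + B) (?L +++ ?U)"
        by (rule has_contour_integral_join) auto
      then show ?thesis using that AB has_contour_integral_unique by blast
    qed
    obtain A1 B1 where 1: "((\<lambda>w. G w / (w - z)) has_contour_integral A1) ?L"
      "((\<lambda>w. G w / (w - z)) has_contour_integral B1) ?U" "A1 + B1 = 2 * pi * \<i> * G z"
      using split[OF C1] by blast
    obtain A2 B2 where 2: "((\<lambda>w. G w / (w - cnj z)) has_contour_integral A2) ?L"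
      "((\<lambda>w. G w / (w - cnj z)) has_contour_integral B2) ?U" "A2 + B2 = 0"
      using split[OF C2] by blast
    \<comment> \<open>The limit at infinity is taken in the open half plane only, so nothing bounds
      \<open>G\<close> by \<open>d\<close> at the two real endpoints of the arc. They form the
      finite exceptional set of the strong estimate.\<close>
    have bound: "cmod B \<le> (d / (R / 2)) * R * (pi - 0)"
      if B: "((\<lambda>w. G w / (w - y)) has_contour_integral B) ?U" and y: "cmod y = cmod z" for B y
    proof (rule has_contour_integral_bound_part_circlepath_strong[OF B, of "{of_real R, - of_real R}"])
      fix w assume w: "w \<in> path_image ?U - {of_real R, - of_real R}"
      have w1: "cmod w = R" "0 \<le> Im w" using w imU imU' by auto
      have "Im w \<noteq> 0"
      proof
        assume "Im w = 0"
        then have "w = of_real (Re w)" "\<bar>Re w\<bar> = R" using w1 by (auto simp: complex_eq_iff cmod_def)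
        then show False using w by (metis Diff_iff abs_if insertCI minus_minus of_real_minus)
      qed
      then have "cmod (G w) \<le> d" using R0[of w] w1 R by auto
      moreover have "R / 2 \<le> cmod (w - y)"
        using norm_triangle_ineq2[of w y] w1 y R by auto
      ultimately show "cmod (G w / (w - y)) \<le> d / (R / 2)"
        using R d by (simp only: norm_divide, intro frac_le) auto
    qed (use d R in auto)
    have b: "cmod B1 \<le> e / 2" "cmod B2 \<le> e / 2"
      using bound[OF 1(2)] bound[OF 2(2)] R by (auto simp: d_def field_simps)
    have L1: "((\<lambda>x. G (of_real x) / (of_real x - z)) has_integral A1) {-R..R}"
      using 1(1) R by (subst (asm) has_contour_integral_linepath_Reals_iff) auto
    have "((\<lambda>x. G (of_real x) / (of_real x - cnj z)) has_integral A2) {-R..R}"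
      using 2(1) R by (subst (asm) has_contour_integral_linepath_Reals_iff) auto
    then have "((\<lambda>x. cnj (G (of_real x) / (of_real x - cnj z))) has_integral cnj A2) {-R..R}"
      by (subst has_integral_cnj[symmetric]) (simp add: o_def)
    from has_integral_diff[OF L1 this]
    have "((\<lambda>x. 2 * \<i> * I x) has_integral A1 - cnj A2) {-R..R}"
      by (simp add: I_def diff_divide_distrib[symmetric] Gcnj)
    \<comment> \<open>The boundary values are real off \<open>{a..b}\<close>, so the integral over
      the diameter does not depend on \<open>R\<close>.\<close>
    moreover have "((\<lambda>x. 2 * \<i> * I x) has_integral 2 * \<i> * integral {a..b} I) {-R..R}"
    proof (rule has_integral_mult_right, rule has_integral_on_superset)
      show "(I has_integral integral {a..b} I) {a..b}"
        using I_int by (rule integrable_integral)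
      show "{a..b} \<subseteq> {-R..R}" using R by auto
      show "I x = 0" if "x \<notin> {a..b}" for x using real[OF that] by (simp add: I_def)
    qed
    ultimately have "A1 - cnj A2 = 2 * \<i> * integral {a..b} I" by (rule has_integral_unique)
    moreover have "A2 = - B2" using 2(3) by (simp add: eq_neg_iff_add_eq_0)
    ultimately have "2 * pi * \<i> * G z - 2 * \<i> * integral {a..b} I = B1 - cnj B2"
      unfolding 1(3)[symmetric] by (simp add: algebra_simps)
    also have "cmod \<dots> \<le> cmod B1 + cmod B2"
      using norm_triangle_ineq4[of B1 "cnj B2"] by simp
    also have "\<dots> \<le> e" using b by simp
    finally show ?thesis .
  qed
  have "cmod (2 * pi * \<i> * G z - 2 * \<i> * integral {a..b} I) \<le> 0"
  proof (rule field_le_epsilon)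
    fix e :: real assume "e > 0"
    then show "cmod (2 * pi * \<i> * G z - 2 * \<i> * integral {a..b} I) \<le> 0 + e"
      using key[of e] by (simp only: add_0_left)
  qed
  then have "2 * pi * \<i> * G z - 2 * \<i> * integral {a..b} I = 0"
    by (simp only: norm_le_zero_iff)
  then have "2 * \<i> * integral {a..b} I = 2 * \<i> * (of_real pi * G z)"
    by (simp add: algebra_simps)
  then have "integral {a..b} I = of_real pi * G z"
    by (simp only: mult_cancel_left) simp
  then show ?thesis
    using integrable_integral[OF I_int[of a b]] by (simp add: I_def[abs_def] G_def)
qed

section \<open>Principal powers on the closed upper half plane\<close>

lemma powr_of_nonpos_real:
  assumes "y \<le> 0"
  shows "complex_of_real y powr of_real a = of_real ((- y) powr a) * exp (\<i> * of_real (pi * a))"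
  using assms by (cases "y = 0") (auto simp: powr_of_real_if mult.assoc)

lemma powr_of_real_mult:
  assumes "0 \<le> c"
  shows "(of_real c * w) powr of_real a = of_real (c powr a) * w powr (of_real a :: complex)"
  using assms by (simp add: powr_times_real_left powr_of_real)

text \<open>The argument is pi on the negative axis, which is its limit from above. Rotation by
  \<open>- \<i>\<close> makes this visible: it carries the closed upper half plane to the closed
  right half plane, away from the cut. At 0 continuity comes from \<open>0 < a\<close>.\<close>

lemma continuous_on_powr_closed_upper:
  assumes "0 < a"
  shows "continuous_on {z. 0 \<le> Im z} (\<lambda>z. z powr complex_of_real a)"
proof -
  have "z powr of_real a = exp (\<i> * of_real (a * pi / 2)) * (- \<i> * z) powr of_real a"
    if "0 \<le> Im z" for z
  proof (cases "z = 0")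
    case False
    have "Ln z = Ln (\<i> * (- \<i> * z))" by (simp only: mult.assoc[symmetric]) simp
    also have "\<dots> = Ln (- \<i> * z) + \<i> * of_real pi / 2"
      using False that by (subst Ln_times_ii) auto
    finally show ?thesis
      using False by (simp add: powr_def exp_add[symmetric] algebra_simps)
  qed simp
  moreover have "continuous_on {z. 0 \<le> Im z}
      (\<lambda>z. exp (\<i> * of_real (a * pi / 2)) * (- \<i> * z) powr complex_of_real a)"
    using assms by (intro continuous_intros) auto
  ultimately show ?thesis
    by (subst continuous_on_cong[OF refl]) auto
qed

text \<open>The arguments of \<open>z\<close> and \<open>z - 1\<close> both lie in (0, pi), so their
  difference lies in (-pi, pi) and no multiple of 2 pi appears.\<close>

lemma Ln_1_minus_inverse:
  assumes "0 < Im z"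
  shows "Ln (1 - 1 / z) = Ln (z - 1) - Ln z"
proof (rule Ln_unique)
  have nz: "z \<noteq> 0" "z - 1 \<noteq> 0" using assms by auto
  then show "exp (Ln (z - 1) - Ln z) = 1 - 1 / z"
    by (simp add: exp_diff diff_divide_distrib)
  show "- pi < Im (Ln (z - 1) - Ln z)" "Im (Ln (z - 1) - Ln z) \<le> pi"
    using Im_Ln_pos_lt[of z] Im_Ln_pos_lt[of "z - 1"] nz assms by auto
qed

section \<open>The function F on the closed upper half plane\<close>

text \<open>This is F in the form free of \<open>1 / z\<close>, which makes sense and is continuous
  at 0 as well. It is matched with the second term of \<open>f_formula\<close> on the open upper
  half plane.\<close>

definition upper_branch :: "real \<Rightarrow> complex \<Rightarrow> complex" where
  "upper_branch p z = z powr of_real (1 / conj_exponent p) *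
     (z powr of_real (1 / conj_exponent p) - (z - 1) powr of_real (1 / conj_exponent p))
       powr of_real (p - 1)"

lemma inv_conj_exponent_mult:
  assumes "p > 1"
  shows "1 / conj_exponent p + (p - 1) * (1 / conj_exponent p) = p - 1"
  using assms by (simp add: conj_exponent_def field_simps)

text \<open>The factorisation \<open>D = z powr r * B\<close> holds, with arg \<open>B\<close> in
  (-pi, 0) and \<open>r\<close> times arg \<open>z\<close> in (0, pi). The sum stays in (-pi, pi),
  so the logarithms add and \<open>D\<close> avoids the cut.\<close>

lemma Ln_upper_branch_base:
  fixes z :: complex and p :: real
  defines "r \<equiv> 1 / conj_exponent p"
  defines "B \<equiv> 1 - (1 - 1 / z) powr of_real r" and "D \<equiv> z powr of_real r - (z - 1) powr of_real r"
  assumes "p > 1" "0 < Im z"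
  shows "Im B < 0" "Ln D = Ln B + of_real r * Ln z" "D \<notin> \<real>\<^sub>\<le>\<^sub>0"
proof -
  have r: "0 < r" "r < 1" using inv_conj_exponent[OF \<open>p > 1\<close>] by (auto simp: r_def)
  show B: "Im B < 0"
    using f_formula_bases(2)[OF \<open>p > 1\<close>, of z] assms(5) by (auto simp: B_def r_def sgn_if split: if_splits)
  have nz: "z \<noteq> 0" "z - 1 \<noteq> 0" "1 - 1 / z \<noteq> 0" "B \<noteq> 0"
    using assms(5) B by (auto simp: field_simps)
  have "(z - 1) powr of_real r = z powr of_real r * (1 - 1 / z) powr of_real r"
    using nz by (simp add: powr_def Ln_1_minus_inverse[OF assms(5)] algebra_simps flip: exp_add)
  then have D: "D = z powr of_real r * B" by (simp add: D_def B_def algebra_simps)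
  then have "D \<noteq> 0" using nz by simp
  have "0 < Im (Ln z)" "Im (Ln z) < pi" using assms(5) nz Im_Ln_pos_lt by blast+
  then have i1: "0 < r * Im (Ln z)" "r * Im (Ln z) < pi"
    using r mult_strict_mono[of r 1 "Im (Ln z)" pi] by auto
  have "Im (Ln B) < 0" using B nz Im_Ln_pos_le[of B] Im_Ln_le_pi[of B] by linarith
  with i1 mpi_less_Im_Ln[OF nz(4)]
  have i2: "- pi < Im (Ln B + of_real r * Ln z)" "Im (Ln B + of_real r * Ln z) < pi" by auto
  show L: "Ln D = Ln B + of_real r * Ln z"
    using i2 nz by (intro Ln_unique) (auto simp: exp_add D powr_def)
  show "D \<notin> \<real>\<^sub>\<le>\<^sub>0"
    using Im_Ln_eq_pi[OF \<open>D \<noteq> 0\<close>] i2 \<open>D \<noteq> 0\<close> unfolding L[symmetric]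
    by (auto simp: complex_nonpos_Reals_iff complex_eq_iff)
qed

text \<open>With the logarithm of \<open>D\<close> split, the exponents of \<open>z\<close> collect
  by \<open>r + (p - 1) * r = p - 1\<close>. The arguments of \<open>z\<close> and \<open>B\<close>
  have opposite signs, so both factors may also stand under one power. The first form matches
  \<open>f_formula\<close>; the second serves the limit at infinity.\<close>

lemma upper_branch_eq:
  assumes "p > 1" "0 < Im z"
  shows "upper_branch p z =
           z powr of_real (p - 1) * (1 - (1 - 1 / z) powr of_real (1 / conj_exponent p)) powr of_real (p - 1)"
    and "upper_branch p z =
           (z * (1 - (1 - 1 / z) powr of_real (1 / conj_exponent p))) powr of_real (p - 1)"
proof -
  define r where "r = 1 / conj_exponent p"
  define B where "B = 1 - (1 - 1 / z) powr of_real r"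
  define D where "D = z powr of_real r - (z - 1) powr of_real r"
  note L = Ln_upper_branch_base[OF assms, folded r_def, folded B_def D_def]
  have nz: "z \<noteq> 0" "B \<noteq> 0" "D \<noteq> 0" using assms L(1,3) by auto
  have rs: "complex_of_real (p - 1) = of_real r + of_real (p - 1) * of_real r"
    using inv_conj_exponent_mult[OF assms(1)] by (simp only: r_def flip: of_real_mult of_real_add)
  have "of_real r * Ln z + of_real (p - 1) * (Ln B + of_real r * Ln z) =
      (of_real r + of_real (p - 1) * of_real r) * Ln z + of_real (p - 1) * Ln B"
    by (simp only: algebra_simps)
  then have e: "of_real r * Ln z + of_real (p - 1) * (Ln B + of_real r * Ln z) =
      of_real (p - 1) * Ln z + of_real (p - 1) * Ln B"
    by (simp only: rs[symmetric])
  have "upper_branch p z = exp (of_real r * Ln z) * exp (of_real (p - 1) * Ln D)"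
    unfolding upper_branch_def r_def[symmetric] D_def[symmetric] using nz by (simp add: powr_def)
  also have "\<dots> = exp (of_real (p - 1) * Ln z + of_real (p - 1) * Ln B)"
    by (simp only: L(2) e exp_add[symmetric])
  finally have u: "upper_branch p z = exp (of_real (p - 1) * Ln z + of_real (p - 1) * Ln B)" .
  show "upper_branch p z = z powr of_real (p - 1) * 
          (1 - (1 - 1 / z) powr of_real (1 / conj_exponent p)) powr of_real (p - 1)"
    unfolding r_def[symmetric] B_def[symmetric] u using nz by (simp add: powr_def exp_add)
  have "0 < Im (Ln z)" "Im (Ln z) < pi" using assms nz Im_Ln_pos_lt by blast+
  moreover have "- pi < Im (Ln B)" "Im (Ln B) < 0"
    using mpi_less_Im_Ln[of B] nz Im_Ln_pos_le[of B] Im_Ln_le_pi[of B] L(1) by auto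
  ultimately have "Ln (z * B) = Ln z + Ln B"
    using nz by (intro Ln_times_simple) auto
  then show "upper_branch p z =
      (z * (1 - (1 - 1 / z) powr of_real (1 / conj_exponent p))) powr of_real (p - 1)"
    unfolding r_def[symmetric] B_def[symmetric] u using nz by (simp add: powr_def distrib_left)
qed

lemma upper_branch_holomorphic:
  assumes "p > 1"
  shows "upper_branch p holomorphic_on {z. 0 < Im z}"
  unfolding upper_branch_def[abs_def]
  using Ln_upper_branch_base(3)[OF assms] 
  by (intro holomorphic_intros) (auto simp: complex_nonpos_Reals_iff)

text \<open>This is the side condition for continuity of a complex power. For
  \<open>1 \<le> x\<close> the base is real and nonnegative; for \<open>x < 1\<close> its imaginary
  part is a negative multiple of \<open>sin (pi * r)\<close>.\<close>

lemma upper_branch_base_boundary: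
  fixes x :: real
  assumes "0 < r" "r < 1"
  defines "D \<equiv> complex_of_real x powr of_real r - (of_real x - 1) powr of_real r"
  shows "0 \<le> Re D \<or> Im D \<noteq> 0"
proof -
  have x1: "complex_of_real x - 1 = of_real (x - 1)" by simp
  have sn: "sin (pi * r) > 0" using assms by (intro sin_gt_zero) auto
  consider "1 \<le> x" | "0 \<le> x" "x < 1" | "x < 0" by linarith
  then show ?thesis
  proof cases
    case 1
    then have "D = of_real (x powr r - (x - 1) powr r)"
      unfolding D_def x1 by (simp add: powr_of_real del: of_real_diff) simp
    then show ?thesis using 1 assms powr_mono2[of r "x - 1" x] by simp
  next
    case 2
    then have "Im D = - ((1 - x) powr r * sin (pi * r))"
      unfolding D_def x1 using powr_of_nonpos_real[of "x - 1" r] by (simp add: powr_of_real Im_exp)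
    then show ?thesis using 2 sn by simp
  next
    case 3
    then have "Im D = ((- x) powr r - (1 - x) powr r) * sin (pi * r)"
      unfolding D_def x1 using powr_of_nonpos_real[of "x - 1" r] powr_of_nonpos_real[of x r]
      by (simp add: Im_exp algebra_simps)
    moreover have "(- x) powr r < (1 - x) powr r" using 3 assms by (intro powr_less_mono2) auto
    ultimately show ?thesis using sn by simp
  qed
qed

lemma upper_branch_continuous:
  assumes "p > 1"
  shows "continuous_on {z. 0 \<le> Im z} (upper_branch p)"
proof -
  define r where "r = 1 / conj_exponent p"
  have r: "0 < r" "r < 1" using inv_conj_exponent[OF assms] by (auto simp: r_def)
  let ?H = "{z. 0 \<le> Im z}"
  have c: "continuous_on ?H (\<lambda>z. z powr complex_of_real r)"
    using r by (intro continuous_on_powr_closed_upper)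
  have c1: "continuous_on ?H (\<lambda>z. (z - 1) powr complex_of_real r)"
    by (rule continuous_on_compose2[OF c]) (auto intro!: continuous_intros)
  have sub: "0 \<le> Re (z powr of_real r - (z - 1) powr of_real r) \<or>
      Im (z powr of_real r - (z - 1) powr of_real r) \<noteq> 0" if "0 \<le> Im z" for z
  proof (cases "Im z = 0")
    case True
    then have "z = of_real (Re z)" by (simp add: complex_eq_iff)
    then show ?thesis using upper_branch_base_boundary[OF r, of "Re z"] by simp
  next
    case False
    then show ?thesis
      using Ln_upper_branch_base(3)[OF assms, of z] that
      by (auto simp: complex_nonpos_Reals_iff r_def)
  qed
  show ?thesis
    unfolding upper_branch_def[abs_def] r_def[symmetric]
    using sub assms by (intro continuous_intros c c1) auto
qed

text \<open>For \<open>x > 1\<close> every power is real. For \<open>x < 0\<close> the total phase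
  is pi times \<open>r + (p - 1) * (r - 1)\<close>, which vanishes by the relation between
  \<open>r\<close> and \<open>p\<close>.\<close>

lemma upper_branch_real:
  assumes "p > 1" "x \<notin> {0..1}"
  shows "Im (upper_branch p (of_real x)) = 0"
proof -
  define r where "r = 1 / conj_exponent p"
  have r: "0 < r" "r < 1" using inv_conj_exponent[OF assms(1)] by (auto simp: r_def)
  have x1: "complex_of_real x - 1 = of_real (x - 1)" by simp
  show ?thesis
  proof (cases "x < 0")
    case False
    then have x: "x > 1" using assms by auto
    then have "x powr r - (x - 1) powr r \<ge> 0" using r powr_mono2[of r "x - 1" x] by simp
    then have "upper_branch p (of_real x) =
        of_real (x powr r * (x powr r - (x - 1) powr r) powr (p - 1))"
      unfolding upper_branch_def r_def[symmetric] x1 using x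
      by (simp only: powr_of_real of_real_mult flip: of_real_diff) 
    then show ?thesis by simp
  next
    case True
    define m where "m = (1 - x) powr r - (- x) powr r"
    have m: "m > 0" using True r powr_less_mono2[of r "- x" "1 - x"] by (simp add: m_def)
    \<comment> \<open>The minus sign is absorbed so that the argument \<open>pi * (r - 1)\<close> is
      the principal one; the outer power then simply multiplies it by \<open>p - 1\<close>.\<close>
    have e: "- exp (\<i> * of_real (pi * r)) = exp (\<i> * of_real (pi * (r - 1)))"
      by (simp add: exp_diff algebra_simps)
    have "complex_of_real x powr of_real r - (of_real x - 1) powr of_real r =
        of_real m * - exp (\<i> * of_real (pi * r))"
      unfolding x1 using True powr_of_nonpos_real[of "x - 1" r] powr_of_nonpos_real[of x r]
      by (simp add: m_def algebra_simps)
    then have "upper_branch p (of_real x) = of_real ((- x) powr r) * exp (\<i> * of_real (pi * r)) *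
        (of_real m * exp (\<i> * of_real (pi * (r - 1)))) powr of_real (p - 1)"
      unfolding upper_branch_def r_def[symmetric] e[symmetric]
      using True powr_of_nonpos_real[of x r] by simp
    also have "\<dots> = of_real ((- x) powr r) * exp (\<i> * of_real (pi * r)) *
        (of_real (m powr (p - 1)) * exp (\<i> * of_real (pi * (r - 1))) powr of_real (p - 1))"
      by (simp only: powr_of_real_mult[OF less_imp_le[OF m]])
    also have "exp (\<i> * of_real (pi * (r - 1))) powr of_real (p - 1) =
        exp (of_real (p - 1) * (\<i> * of_real (pi * (r - 1))))"
    proof -
      have "- pi < pi * (r - 1)" "pi * (r - 1) \<le> pi"
        using r mult_strict_left_mono[of "-1" "r - 1" pi] mult_left_mono[of "r - 1" 1 pi] by auto
      then have "Ln (exp (\<i> * of_real (pi * (r - 1)))) = \<i> * of_real (pi * (r - 1))"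
        by (intro Ln_exp) auto
      then show ?thesis by (simp add: powr_def)
    qed
    finally have "upper_branch p (of_real x) = of_real ((- x) powr r * m powr (p - 1)) *
        exp (\<i> * of_real (pi * r) + of_real (p - 1) * (\<i> * of_real (pi * (r - 1))))"
      by (simp only: exp_add of_real_mult mult_ac)
    also have "\<i> * of_real (pi * r) + of_real (p - 1) * (\<i> * of_real (pi * (r - 1))) =
        \<i> * of_real (pi * (r + (p - 1) * r - (p - 1)))"
      by (simp add: algebra_simps)
    also have "r + (p - 1) * r - (p - 1) = 0"
      using inv_conj_exponent_mult[OF assms(1)] by (simp add: r_def)
    finally show ?thesis by simp
  qed
qed

section \<open>The density as a boundary value, and its positivity\<close>

text \<open>Pulling the positive factor \<open>x powr r\<close> out of the base leaves the base in
  \<open>rho_formula\<close>, and the powers of \<open>x\<close> combine to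
  \<open>x powr (p - 1)\<close>. At 0, where \<open>rho\<close> is a limit, both sides are
  0.\<close>

lemma rho_eq_Im_upper_branch:
  assumes "p > 1" "x \<in> {0..1}"
  shows "rho p x = - Im (upper_branch p (of_real x)) / pi"
proof (cases "x = 0")
  case True
  then show ?thesis using rho_0(2)[OF assms(1)] by (simp add: upper_branch_def)
next
  case False
  then have x: "0 < x" "x \<le> 1" using assms by auto
  define r where "r = 1 / conj_exponent p"
  have x1: "complex_of_real x - 1 = of_real (x - 1)" by simp
  define w where "w = 1 - exp (\<i> * of_real (pi * r)) * of_real ((1 / x - 1) powr r)"
  have "1 - x = x * (1 / x - 1)" using x by (simp add: field_simps)
  then have "(1 - x) powr r = x powr r * (1 / x - 1) powr r" by (simp only: powr_mult)
  then have "complex_of_real x powr of_real r - (of_real x - 1) powr of_real r = of_real (x powr r) * w"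
    unfolding x1 using x powr_of_nonpos_real[of "x - 1" r]
    by (simp add: powr_of_real w_def algebra_simps)
  then have "upper_branch p (of_real x) =
      of_real (x powr r) * (of_real ((x powr r) powr (p - 1)) * w powr of_real (p - 1))"
    unfolding upper_branch_def r_def[symmetric] using x
    by (simp only: powr_of_real_mult[of "x powr r"] powr_of_real less_imp_le powr_gt_zero powr_ge_zero)
  also have "\<dots> = of_real (x powr (r + r * (p - 1))) * w powr of_real (p - 1)"
    by (simp add: powr_powr powr_add)
  also have "r + r * (p - 1) = p - 1"
    using inv_conj_exponent_mult[OF assms(1)] by (simp add: r_def)
  finally show ?thesis
    using False by (simp add: rho_def rho_formula_def w_def r_def)
qed

lemma rho_pos:
  assumes "p > 1" "0 < x" "x < 1"
  shows "rho p x > 0"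
proof -
  define r where "r = 1 / conj_exponent p"
  have r: "0 < r" "r < 1" using inv_conj_exponent[OF assms(1)] by (auto simp: r_def)
  define Y where "Y = (1 / x - 1) powr r"
  have Y: "Y > 0" using assms by (simp add: Y_def field_simps)
  define w where "w = 1 - exp (\<i> * of_real (pi * r)) * of_real Y"
  have sn: "sin (pi * r) > 0" using r by (intro sin_gt_zero) auto
  have "Im w < 0" using sn Y by (simp add: w_def Im_exp)
  then have wnz: "w \<noteq> 0" by auto
  define \<theta> where "\<theta> = Im (Ln w)"
  have th: "- pi < \<theta>" "\<theta> < 0"
    using mpi_less_Im_Ln[of w] wnz Im_Ln_pos_le[of w] Im_Ln_le_pi[of w] \<open>Im w < 0\<close> by (auto simp: \<theta>_def)
  \<comment> \<open>Rotating \<open>w\<close> by \<open>pi * (1 - r)\<close> makes its imaginary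
    part \<open>sin (pi * r) > 0\<close>. This yields the lower bound on its argument.\<close>
  have "w * exp (\<i> * of_real (pi * (1 - r))) = of_real Y - exp (- (\<i> * of_real (pi * r)))"
  proof -
    have "exp (\<i> * of_real (pi * (1 - r))) = - exp (- (\<i> * of_real (pi * r)))"
      by (simp add: exp_diff exp_minus algebra_simps divide_inverse)
    then show ?thesis
      by (simp add: w_def algebra_simps exp_minus)
  qed
  then have "Im (w * exp (\<i> * of_real (pi * (1 - r)))) > 0"
    using sn by (simp add: Im_exp)
  moreover have "w * exp (\<i> * of_real (pi * (1 - r))) = exp (Ln w + \<i> * of_real (pi * (1 - r)))"
    using wnz by (simp add: exp_add)
  ultimately have "0 < Im (exp (Ln w + \<i> * of_real (pi * (1 - r))))"
    by (simp only:)
  then have "sin (\<theta> + pi * (1 - r)) > 0"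
    unfolding Im_exp by (simp add: \<theta>_def zero_less_mult_iff)
  \<comment> \<open>The angle exceeds -pi, so if it were nonpositive its sine could not be
    positive.\<close>
  moreover have "sin (\<theta> + pi * (1 - r)) \<le> 0" if "\<theta> + pi * (1 - r) \<le> 0"
  proof -
    have "0 < pi * (1 - r)" using r by simp
    then have "0 \<le> sin (- (\<theta> + pi * (1 - r)))"
      using th that by (intro sin_ge_zero) linarith+
    then show ?thesis by (simp only: sin_minus)
  qed
  ultimately have "- (pi * (1 - r)) < \<theta>" by linarith
  then have "(p - 1) * - (pi * (1 - r)) < (p - 1) * \<theta>"
    using assms(1) by (intro mult_strict_left_mono) auto
  \<comment> \<open>This scales the bound to \<open>- (pi * r) < (p - 1) * \<theta>\<close>, so the
    argument of the power stays in (-pi, 0).\<close>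
  moreover have "(p - 1) * (1 - r) = r"
    using inv_conj_exponent_mult[OF assms(1)] by (simp add: r_def algebra_simps)
  then have "(p - 1) * - (pi * (1 - r)) = - (pi * r)" by (simp add: mult.left_commute)
  moreover have "pi * r < pi" using r by simp
  moreover have "(p - 1) * \<theta> < 0" using th assms(1) by (simp add: mult_pos_neg)
  ultimately have "sin (- ((p - 1) * \<theta>)) > 0" by (intro sin_gt_zero) linarith+
  then have "Im (w powr of_real (p - 1)) < 0"
    using wnz by (simp add: powr_def Im_exp \<theta>_def mult_pos_neg)
  then show ?thesis
    using assms(2) by (simp add: rho_def rho_formula_def w_def r_def Y_def mult_pos_neg divide_neg_pos)
qed

section \<open>Limit at infinity and the integral formula off the real axis\<close>

text \<open>With \<open>u = 1 / z\<close>, the base of the one-power form is the difference quotient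
  at 0 of \<open>1 - (1 - u) powr r\<close>, whose derivative there is \<open>r\<close>.\<close>

lemma upper_branch_at_infinity:
  assumes "p > 1"
  shows "(upper_branch p \<longlongrightarrow> of_real ((1 / conj_exponent p) powr (p - 1)))
           (inf at_infinity (principal {z. 0 < Im z}))"
proof -
  define r where "r = 1 / conj_exponent p"
  have r: "0 < r" using inv_conj_exponent[OF assms] by (auto simp: r_def)
  let ?g = "\<lambda>u. 1 - (1 - u) powr complex_of_real r"
  have "(?g has_field_derivative of_real r) (at 0)"
    by (auto intro!: derivative_eq_intros)
  then have "((\<lambda>u. (?g (0 + u) - ?g 0) / u) \<longlongrightarrow> of_real r) (at 0)"
    by (simp only: DERIV_def)
  then have "((\<lambda>u. ?g u / u) \<longlongrightarrow> of_real r) (at 0)" by simp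
  moreover have "filterlim (\<lambda>z :: complex. inverse z) (at 0) at_infinity"
    by (simp add: at_to_infinity filterlim_def)
  ultimately have "((\<lambda>z. ?g (inverse z) / inverse z) \<longlongrightarrow> of_real r) at_infinity"
    by (rule filterlim_compose)
  then have "((\<lambda>z. z * (1 - (1 - 1 / z) powr complex_of_real r)) \<longlongrightarrow> of_real r) at_infinity"
    by (simp add: inverse_eq_divide mult.commute)
  then have "((\<lambda>z. (z * (1 - (1 - 1 / z) powr of_real r)) powr complex_of_real (p - 1))
      \<longlongrightarrow> of_real r powr of_real (p - 1)) at_infinity"
    using r by (intro tendsto_powr_complex tendsto_const) auto
  then have "((\<lambda>z. (z * (1 - (1 - 1 / z) powr of_real r)) powr complex_of_real (p - 1))
      \<longlongrightarrow> of_real (r powr (p - 1))) (inf at_infinity (principal {z. 0 < Im z}))"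
    using r by (simp add: powr_of_real tendsto_mono[OF inf_le1] del: of_real_diff)
  moreover have "eventually (\<lambda>z. upper_branch p z =
      (z * (1 - (1 - 1 / z) powr of_real r)) powr of_real (p - 1))
      (inf at_infinity (principal {z. 0 < Im z}))"
    by (auto simp: eventually_inf_principal r_def upper_branch_eq(2)[OF assms] simp del: of_real_divide)
  ultimately show ?thesis
    by (simp only: r_def tendsto_cong)
qed

text \<open>The reflection of \<open>z\<close> to \<open>- cnj z\<close> preserves the upper half
  plane and turns \<open>1 - 1 / z\<close> into the conjugate of \<open>1 + 1 / z\<close>. The first
  term of \<open>f_formula\<close> is thus the conjugate of F at the reflected point, up to signs
  that \<open>powr_minus_times\<close> removes.\<close>

lemma f_formula_eq_upper_branch:
  assumes "p > 1" "0 < Im z"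
  shows "f_formula p z = cnj (upper_branch p (- cnj z)) - upper_branch p z"
proof -
  define A where "A = (1 + 1 / z) powr of_real (1 / conj_exponent p) - 1"
  have "Im z \<noteq> 0" using assms by simp
  have A: "Im A \<noteq> 0" "sgn (Im A) = - sgn (Im z)"
    using f_formula_bases(1)[OF assms(1) \<open>Im z \<noteq> 0\<close>, folded A_def] assms(2)
    by (auto simp: sgn_if split: if_splits)
  have nz: "Im (1 + 1 / z) \<noteq> 0" using sgn_Im_inverse[OF \<open>Im z \<noteq> 0\<close>] by simp
  have "1 - (1 - 1 / (- cnj z)) powr of_real (1 / conj_exponent p) = cnj (- A)"
    using cnj_powr[of "1 + 1 / z" "of_real (1 / conj_exponent p)"] nz by (simp add: A_def)
  then have "cnj (upper_branch p (- cnj z)) =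
      (- z) powr of_real (p - 1) * (- A) powr of_real (p - 1)"
    using upper_branch_eq(1)[OF assms(1), of "- cnj z"] assms A(1)
      cnj_powr[of "- cnj z" "of_real (p - 1)"] cnj_powr[of "- cnj A" "of_real (p - 1)"] by simp
  also have "\<dots> = z powr of_real (p - 1) * A powr of_real (p - 1)"
    using powr_minus_times[OF \<open>Im z \<noteq> 0\<close> A] .
  finally show ?thesis
    unfolding f_formula_def A_def[symmetric] upper_branch_eq(1)[OF assms]
    by (simp add: right_diff_distrib)
qed

lemma upper_branch_integral:
  assumes "p > 1" "0 < Im z"
  shows "((\<lambda>t. of_real (rho p \<bar>t\<bar>) / (of_real t - z)) has_integral
           (of_real ((1 / conj_exponent p) powr (p - 1)) - upper_branch p z)) {0..1}"
proof -
  let ?c = "complex_of_real ((1 / conj_exponent p) powr (p - 1))"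
  have "((\<lambda>t. of_real (Im (upper_branch p (of_real t))) / (of_real t - z)) has_integral
      of_real pi * (upper_branch p z - ?c)) {0..1}"
    using upper_branch_continuous[OF assms(1)] upper_branch_holomorphic[OF assms(1)]
      upper_branch_at_infinity[OF assms(1)] upper_branch_real[OF assms(1)] assms(2)
    by (rule half_plane_Cauchy)
  from has_integral_mult_right[OF this, of "- 1 / of_real pi"]
  have "((\<lambda>t. - 1 / of_real pi * (of_real (Im (upper_branch p (of_real t))) / (of_real t - z)))
      has_integral ?c - upper_branch p z) {0..1}"
    by simp
  then show ?thesis
    by (rule has_integral_eq[rotated]) (simp add: rho_eq_Im_upper_branch[OF assms(1)])
qed

lemma f_formula_integral:
  assumes "p > 1" "Im z \<noteq> 0"
  shows "((\<lambda>t. of_real (rho p \<bar>t\<bar>) / (of_real t - z)) has_integral f_formula p z) {-1..1}"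
proof -
  let ?c = "complex_of_real ((1 / conj_exponent p) powr (p - 1))"
  let ?k = "\<lambda>z t. complex_of_real (rho p \<bar>t\<bar>) / (of_real t - z)"
  have upper: "(?k z has_integral f_formula p z) {-1..1}" if z: "0 < Im z" for z
  proof -
    \<comment> \<open>The conjugate of \<open>1 / (t + cnj z)\<close> is minus the kernel of
      \<open>z\<close> at \<open>- t\<close>, so conjugation, negation and reflection move this
      formula to \<open>{-1..0}\<close>.\<close>
    have "(?k (- cnj z) has_integral ?c - upper_branch p (- cnj z)) {0..1}"
      using z by (intro upper_branch_integral[OF assms(1)]) simp
    then have "((\<lambda>t. cnj (?k (- cnj z) t)) has_integral cnj (?c - upper_branch p (- cnj z))) {0..1}"
      by (subst (asm) has_integral_cnj[symmetric]) (simp add: o_def)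
    from has_integral_neg[OF this]
    have "((\<lambda>t. ?k z (- t)) has_integral cnj (upper_branch p (- cnj z)) - ?c) {0..1}"
      by (rule has_integral_eq_rhs[OF has_integral_eq[rotated]])
        (simp_all add: minus_divide_right)
    then have "(?k z has_integral cnj (upper_branch p (- cnj z)) - ?c) {-1..0}"
      using has_integral_reflect_real[of "?k z" "cnj (upper_branch p (- cnj z)) - ?c" 0 "-1"] by simp
    from has_integral_combine[OF _ _ this upper_branch_integral[OF assms(1) z]]
    show ?thesis by (simp add: f_formula_eq_upper_branch[OF assms(1) z])
  qed
  show ?thesis
  proof (cases "0 < Im z")
    case False
    then have "(?k (- z) has_integral f_formula p (- z)) {-1..1}"
      using assms by (intro upper) auto
    from has_integral_neg[OF this]
    have "((\<lambda>t. ?k z (- t)) has_integral f_formula p z) {-1..1}"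
      by (rule has_integral_eq_rhs[OF has_integral_eq[rotated]])
        (simp_all add: minus_divide_right f_formula_odd[OF assms])
    then show ?thesis
      using has_integral_reflect_real[of "?k z" "f_formula p z" 1 "-1"] by simp
  qed (rule upper)
qed

section \<open>Extension to the whole slit plane and conclusion\<close>

lemma continuous_on_rho_abs:
  assumes "p > 1"
  shows "continuous_on {-1..1} (\<lambda>t. rho p \<bar>t\<bar>)"
proof -
  have "continuous_on {-1..1 :: real} (\<lambda>t. upper_branch p (of_real \<bar>t\<bar>))"
    by (rule continuous_on_compose2[OF upper_branch_continuous[OF assms]])
      (auto intro!: continuous_intros)
  then have "continuous_on {-1..1 :: real} (\<lambda>t. - Im (upper_branch p (of_real \<bar>t\<bar>)) / pi)"
    by (intro continuous_intros) auto
  then show ?thesis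
    by (subst continuous_on_cong[OF refl rho_eq_Im_upper_branch[OF assms]]) auto
qed

text \<open>Joint continuity makes the integral continuous in the parameter
  \<open>z\<close>.\<close>

lemma continuous_on_stieltjes_kernel:
  assumes "p > 1"
  shows "continuous_on ((- complex_of_real ` {-1..1}) \<times> {-1..1})
           (\<lambda>(z, t). of_real (rho p \<bar>t\<bar>) / (of_real t - z))"
proof -
  have "continuous_on ((- complex_of_real ` {-1..1}) \<times> {-1..1 :: real}) (\<lambda>x. rho p \<bar>snd x\<bar>)"
    by (rule continuous_on_compose2[OF continuous_on_rho_abs[OF assms]])
      (auto intro!: continuous_intros)
  then show ?thesis
    unfolding case_prod_unfold by (intro continuous_intros) auto
qed

lemma f_fun_integral:
  assumes "p > 1" and z: "z \<in> - complex_of_real ` {-1..1}"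
  shows "f_fun p z = integral {-1..1} (\<lambda>t. of_real (rho p \<bar>t\<bar>) / (of_real t - z))"
proof -
  let ?S = "- complex_of_real ` {-1..1}"
  let ?J = "\<lambda>z. integral {-1..1} (\<lambda>t. complex_of_real (rho p \<bar>t\<bar>) / (of_real t - z))"
  have ext: "f_fun p analytic_on ?S" "\<And>w. Im w \<noteq> 0 \<Longrightarrow> f_fun p w = f_formula p w"
    using f_fun_extension[OF assms(1)] by (auto simp: is_extension_def)
  have contJ: "continuous_on ?S ?J"
    using integral_continuous_on_param[of ?S "-1" 1 "\<lambda>z t. complex_of_real (rho p \<bar>t\<bar>) / (of_real t - z)"]
      continuous_on_stieltjes_kernel[OF assms(1)] by simp
  have contf: "continuous_on ?S (f_fun p)"
    using ext(1) by (intro holomorphic_on_imp_continuous_on analytic_imp_holomorphic)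
  have eq: "f_fun p w = ?J w" if "Im w \<noteq> 0" for w
    using ext(2)[OF that] f_formula_integral[OF assms(1) that] by (simp add: integral_unique)
  \<comment> \<open>A real point off \<open>[-1,1]\<close> is approached vertically through nonreal
    points, where the formula is known; both sides are continuous there.\<close>
  let ?X = "\<lambda>n. z + \<i> * of_real (1 / real (Suc n))"
  show ?thesis
  proof (cases "Im z = 0")
    case True
    have "(\<lambda>n. of_real (1 / real (Suc n))) \<longlonglongrightarrow> (of_real 0 :: complex)"
      by (intro tendsto_of_real LIMSEQ_Suc[OF lim_inverse_n'])
    then have "?X \<longlonglongrightarrow> z + \<i> * of_real 0"
      by (intro tendsto_add tendsto_mult tendsto_const)
    then have lim: "?X \<longlonglongrightarrow> z" by simp
    have lim_at: "(\<lambda>n. g (?X n)) \<longlonglongrightarrow> g z" if "continuous_on ?S g" for g :: "complex \<Rightarrow> complex"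
      using that z open_slit_plane lim
      by (intro isCont_tendsto_compose[of _ g]) (auto simp: continuous_on_eq_continuous_at)
    have "f_fun p (?X n) = ?J (?X n)" for n
      using True by (intro eq) simp
    then show ?thesis
      using lim_at[OF contf] lim_at[OF contJ] by (simp only: LIMSEQ_unique)
  qed (rule eq)
qed

theorem theorem1:
  fixes p :: real
  assumes "p > 1"
  shows "herglotz_nevanlinna (f_fun p) \<and>
    (\<forall>x\<in>{0<..<1}. rho p x > 0) \<and>
    (\<forall>z\<in>- complex_of_real ` {-1..1}.
       set_integrable lborel {-1..1} (\<lambda>t. of_real (rho p \<bar>t\<bar>) / (of_real t - z)) \<and>
       f_fun p z = (LINT t:{-1..1}|lborel. of_real (rho p \<bar>t\<bar>) / (of_real t - z)))"
proof (intro conjI ballI)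
  have ext: "f_fun p analytic_on - complex_of_real ` {-1..1}"
    "\<And>w. Im w \<noteq> 0 \<Longrightarrow> f_fun p w = f_formula p w"
    using f_fun_extension[OF assms] by (auto simp: is_extension_def)
  \<comment> \<open>At 1 the base of the power in \<open>rho_formula\<close> is 1, which has no
    imaginary part; at 0 the value is the limit 0.\<close>
  have rho_nonneg: "rho p t \<ge> 0" if "0 \<le> t" "t \<le> 1" for t
    using that rho_0(2)[OF assms] rho_pos[OF assms, of t]
    by (cases "t = 0 \<or> t = 1") (auto simp: rho_def rho_formula_def)
  show "herglotz_nevanlinna (f_fun p)"
    unfolding herglotz_nevanlinna_def
  proof (intro conjI allI impI)
    show "f_fun p analytic_on {z. Im z > 0}"
      using ext(1) by (rule analytic_on_subset) auto
    fix z :: complex assume z: "Im z > 0"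
    let ?k = "\<lambda>t. complex_of_real (rho p \<bar>t\<bar>) / (of_real t - z)"
    have "(?k has_integral f_fun p z) {-1..1}"
      using f_formula_integral[OF assms, of z] ext(2)[of z] z by simp
    from has_integral_linear[OF this bounded_linear_Im]
    have "((\<lambda>t. Im (?k t)) has_integral Im (f_fun p z)) {-1..1}" by (simp add: o_def)
    then show "Im (f_fun p z) \<ge> 0"
    proof (rule has_integral_nonneg)
      fix t :: real assume "t \<in> {-1..1}"
      then have "rho p \<bar>t\<bar> \<ge> 0" by (intro rho_nonneg) auto
      \<comment> \<open>The imaginary part of \<open>1 / (t - z)\<close> is \<open>Im z\<close>
        divided by the squared modulus of \<open>t - z\<close>.\<close>
      then show "0 \<le> Im (?k t)" using z by (simp add: Im_divide)
    qed
  qed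
  show "rho p x > 0" if "x \<in> {0<..<1}" for x
    using rho_pos[OF assms] that by simp
  fix z assume z: "z \<in> - complex_of_real ` {-1..1}"
  \<comment> \<open>Continuity on the compact interval gives Lebesgue integrability, and then the
    Lebesgue integral agrees with the gauge integral used so far.\<close>
  have "continuous_on {-1..1} (\<lambda>t. complex_of_real (rho p \<bar>t\<bar>) / (of_real t - z))"
    using z by (intro continuous_intros continuous_on_rho_abs[OF assms]) auto
  then show int: "set_integrable lborel {-1..1} (\<lambda>t. complex_of_real (rho p \<bar>t\<bar>) / (of_real t - z))"
    by (rule borel_integrable_atLeastAtMost')
  show "f_fun p z = (LINT t:{-1..1}|lborel. of_real (rho p \<bar>t\<bar>) / (of_real t - z))"
    using set_borel_integral_eq_integral(2)[OF int] f_fun_integral[OF assms z] by simp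
qed

end
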